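(* The expected height of a partial packing path chosen uniformly at random among all partial packing paths of width $n$ is asymptotically equivalent, as $n\to\infty$, to $$\sqrt{\frac{\pi n}{2}}.$$
   Context: Consider the hexagonal packing of the plane by circles of radius $2$ with centers $(2+4i+2j,\,2\sqrt3\,j)$, $i,j\in\mathbb Z$; the origin is the tangency point of two horizontally adjacent circles. The tangency points cut every circle into six arcs. Traversed from left to right these give six types of steps (angles measured on the circle carrying the arc): $U$ from $180^\circ$ to $120^\circ$ (displacement $(1,\sqrt3)$), $F$ from $120^\circ$ to $60^\circ$ (displacement $(2,0)$), $D$ from $60^\circ$ to $0^\circ$ (displacement $(1,-\sqrt3)$), $\overline U$ from $300^\circ$ to $360^\circ$ (displacement $(1,\sqrt3)$), $\overline F$ from $240^\circ$ to $300^\circ$ (displacement $(2,0)$), $\overline D$ from $180^\circ$ to $240^\circ$ (displacement $(1,-\sqrt3)$). A path in the packing starts at the origin, is a concatenation of such arcs of circles of the packing, each starting where the previous one ends, and stays in the quarter plane $x,y\ge 0$. Equivalently, it is a word in $\{U,F,D,\overline U,\overline F,\overline D\}$ whose first step (if any) is $U$, in which $U$ or $\overline F$ can only be followed by $F$ or $\overline U$; $F$ or $\overline D$ only by $\overline F$ or $D$; $\overline U$ or $D$ only by $U$ or $\overline D$; and which never goes below ordinate $0$. A packing path is such a path ending on the $x$-axis; a partial packing path is any prefix of a packing path. The empty path is allowed. The width of a path is the abscissa of its endpoint (so $U,D,\overline U,\overline D$ contribute $1$ and $F,\overline F$ contribute $2$). The (final) height of a path is the integer $k$ such that its endpoint has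 ordinate $k\sqrt3$. *)

theory Defs
  imports "HOL-Probability.Probability" "HOL-Library.Landau_Symbols"
begin

text \<open>
  The plane is identified with the complex numbers.
\<close>

definition centers :: "complex set" where
  "centers = {Complex (2 + 4 * of_int i + 2 * of_int j) (2 * sqrt 3 * of_int j) | i j :: int. True}"

definition quarter_plane :: "complex set" where
  "quarter_plane = {z. Re z \<ge> 0 \<and> Im z \<ge> 0}"

text \<open>
  \<open>Ub\<close>, \<open>Fb\<close>, \<open>Db\<close> are the overlined (lower-half) arcs. A step together with its starting
  point determines an arc, hence also the circle that carries it.
\<close>

datatype step = U | F | D | Ub | Fb | Db

fun start_angle :: "step \<Rightarrow> real" where
  "start_angle U = pi"
| "start_angle F = 2 * pi / 3"
| "start_angle D = pi / 3"
| "start_angle Ub = 5 * pi / 3"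
| "start_angle Fb = 4 * pi / 3"
| "start_angle Db = pi"

fun end_angle :: "step \<Rightarrow> real" where
  "end_angle U = 2 * pi / 3"
| "end_angle F = pi / 3"
| "end_angle D = 0"
| "end_angle Ub = 2 * pi"
| "end_angle Fb = 5 * pi / 3"
| "end_angle Db = 4 * pi / 3"

text \<open>Center of the circle of radius 2 carrying the arc of type \<open>s\<close> that starts at \<open>p\<close>.\<close>

definition arc_center :: "complex \<Rightarrow> step \<Rightarrow> complex" where
  "arc_center p s = p - 2 * cis (start_angle s)"

definition arc_points :: "complex \<Rightarrow> step \<Rightarrow> complex set" where
  "arc_points p s =
     (\<lambda>t. arc_center p s + 2 * cis t) ` closed_segment (start_angle s) (end_angle s)"

definition arc_end :: "complex \<Rightarrow> step \<Rightarrow> complex" where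
  "arc_end p s = arc_center p s + 2 * cis (end_angle s)"

fun packing_from :: "complex \<Rightarrow> step list \<Rightarrow> bool" where
  "packing_from p [] \<longleftrightarrow> p \<in> quarter_plane"
| "packing_from p (s # w) \<longleftrightarrow>
     arc_center p s \<in> centers \<and> arc_points p s \<subseteq> quarter_plane \<and> packing_from (arc_end p s) w"

definition path_in_packing :: "step list \<Rightarrow> bool" where
  "path_in_packing w \<longleftrightarrow> packing_from 0 w"

definition endpoint :: "step list \<Rightarrow> complex" where
  "endpoint w = foldl arc_end 0 w"

definition packing_path :: "step list \<Rightarrow> bool" where
  "packing_path w \<longleftrightarrow> path_in_packing w \<and> Im (endpoint w) = 0"

definition partial_packing_path :: "step list \<Rightarrow> bool" where
  "partial_packing_path w \<longleftrightarrow> (\<exists>v. packing_path (w @ v))"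

definition path_width :: "step list \<Rightarrow> real" where
  "path_width w = Re (endpoint w)"

definition path_height :: "step list \<Rightarrow> int" where
  "path_height w = (THE k. Im (endpoint w) = of_int k * sqrt 3)"

definition partial_packing_paths :: "nat \<Rightarrow> step list set" where
  "partial_packing_paths n = {w. partial_packing_path w \<and> path_width w = real n}"

text \<open>
  Sanity checks: displacements of the six steps, the purely combinatorial description of paths
  as words, and the fact that there are finitely many (and at least one) partial packing paths
  of every width, so that the uniform distribution on them makes sense.
\<close>

fun step_width :: "step \<Rightarrow> nat" where
  "step_width F = 2"
| "step_width Fb = 2"
| "step_width _ = 1"

fun step_height :: "step \<Rightarrow> int" where
  "step_height U = 1"
| "step_height Ub = 1"
| "step_height F = 0"
| "step_height Fb = 0"
| "step_height D = - 1"
| "step_height Db = - 1"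

fun follows :: "step \<Rightarrow> step \<Rightarrow> bool" where
  "follows U t \<longleftrightarrow> t \<in> {F, Ub}"
| "follows Fb t \<longleftrightarrow> t \<in> {F, Ub}"
| "follows F t \<longleftrightarrow> t \<in> {Fb, D}"
| "follows Db t \<longleftrightarrow> t \<in> {Fb, D}"
| "follows Ub t \<longleftrightarrow> t \<in> {U, Db}"
| "follows D t \<longleftrightarrow> t \<in> {U, Db}"

lemma cos_sin_angles:
  "cos (2 * pi / 3) = - 1 / 2" "sin (2 * pi / 3) = sqrt 3 / 2"
  "cos (4 * pi / 3) = - 1 / 2" "sin (4 * pi / 3) = - sqrt 3 / 2"
  "cos (5 * pi / 3) = 1 / 2" "sin (5 * pi / 3) = - sqrt 3 / 2"
proof -
  have a: "2 * pi / 3 = pi - pi / 3" "4 * pi / 3 = pi / 3 + pi" "5 * pi / 3 = 2 * pi - pi / 3"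
    by simp_all
  show "cos (2 * pi / 3) = - 1 / 2" "sin (2 * pi / 3) = sqrt 3 / 2"
    by (simp_all only: a(1) cos_pi_minus sin_pi_minus cos_60 sin_60)
  show "cos (4 * pi / 3) = - 1 / 2" "sin (4 * pi / 3) = - sqrt 3 / 2"
    by (simp_all only: a(2) cos_periodic_pi sin_periodic_pi cos_60 sin_60)
  show "cos (5 * pi / 3) = 1 / 2" "sin (5 * pi / 3) = - sqrt 3 / 2"
    by (simp_all only: a(3) cos_2pi_minus sin_2pi_minus cos_60 sin_60)
qed

lemma arc_end_eq: "arc_end p s = p + Complex (step_width s) (step_height s * sqrt 3)"
  by (cases s) (auto simp: arc_end_def arc_center_def complex_eq_iff cos_sin_angles cos_60 sin_60)

lemma foldl_arc_end:
  "foldl arc_end p w =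
     p + Complex (sum_list (map step_width w)) (sum_list (map step_height w) * sqrt 3)"
  by (induction w arbitrary: p) (auto simp: arc_end_eq complex_eq_iff algebra_simps)

lemma path_width_eq: "path_width w = sum_list (map step_width w)"
  by (simp add: path_width_def endpoint_def foldl_arc_end)

lemma path_height_eq: "path_height w = sum_list (map step_height w)"
  unfolding path_height_def endpoint_def foldl_arc_end by (rule the_equality) auto

lemma Im_endpoint: "Im (endpoint w) = path_height w * sqrt 3"
  by (simp add: endpoint_def path_height_eq foldl_arc_end)

lemma centers_iff:
  "Complex (of_int a) (of_int b * sqrt 3) \<in> centers \<longleftrightarrow> even b \<and> 4 dvd (a - 2 - b)"
proof
  assume "Complex (of_int a) (of_int b * sqrt 3) \<in> centers"
  then obtain i j :: int where
    "of_int a = (2 + 4 * of_int i + 2 * of_int j :: real)" "of_int b * sqrt 3 = 2 * sqrt 3 * of_int j"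
    by (auto simp: centers_def)
  hence "real_of_int a = of_int (2 + 4 * i + 2 * j)" "real_of_int b = of_int (2 * j)"
    by simp_all
  hence "a = 2 + 4 * i + 2 * j" "b = 2 * j"
    unfolding of_int_eq_iff by simp_all
  thus "even b \<and> 4 dvd (a - 2 - b)" by simp
next
  assume "even b \<and> 4 dvd (a - 2 - b)"
  then obtain i j where "b = 2 * j" "a - 2 - b = 4 * i" by (auto elim!: dvdE)
  hence "a = 2 + 4 * i + 2 * j" "b = 2 * j" by simp_all
  thus "Complex (of_int a) (of_int b * sqrt 3) \<in> centers"
    by (auto simp: centers_def)
qed

text \<open>
  \<open>step_at x y s\<close> characterizes when the arc of type \<open>s\<close> starting at \<open>(x, y * sqrt 3)\<close> lies on
  a circle of the packing.
\<close>

fun step_at :: "int \<Rightarrow> int \<Rightarrow> step \<Rightarrow> bool" where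
  "step_at x y s \<longleftrightarrow>
     (if s \<in> {U, Db} then even y \<and> 4 dvd (x - y)
      else if s \<in> {F, Ub} then odd y \<and> 4 dvd (x - y)
      else odd y \<and> 4 dvd (x - y - 2))"

abbreviation grid :: "int \<Rightarrow> int \<Rightarrow> complex" where
  "grid x y \<equiv> Complex (of_int x) (of_int y * sqrt 3)"

lemma arc_center_grid:
  "arc_center (grid x y) s =
     (case s of U \<Rightarrow> grid (x + 2) y | Db \<Rightarrow> grid (x + 2) y
      | F \<Rightarrow> grid (x + 1) (y - 1) | Ub \<Rightarrow> grid (x - 1) (y + 1)
      | D \<Rightarrow> grid (x - 1) (y - 1) | Fb \<Rightarrow> grid (x + 1) (y + 1))"
  by (cases s)
     (simp_all add: arc_center_def complex_eq_iff cos_sin_angles cos_60 sin_60 ring_distribs)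

lemma arc_center_in_centers: "arc_center (grid x y) s \<in> centers \<longleftrightarrow> step_at x y s"
proof (cases s)
  case U show ?thesis unfolding arc_center_grid U step.case centers_iff by simp
next
  case F show ?thesis unfolding arc_center_grid F step.case centers_iff by simp
next
  case D show ?thesis unfolding arc_center_grid D step.case centers_iff by (simp, presburger?)
next
  case Ub show ?thesis unfolding arc_center_grid Ub step.case centers_iff by (simp, presburger?)
next
  case Fb show ?thesis unfolding arc_center_grid Fb step.case centers_iff by (simp, presburger?)
next
  case Db show ?thesis unfolding arc_center_grid Db step.case centers_iff by simp
qed

lemma step_at_next:
  assumes "step_at x y s"
  shows "step_at (x + step_width s) (y + step_height s) t \<longleftrightarrow> follows s t"
  using assms by (cases s; cases t; simp; presburger?)

lemma arc_end_grid: "arc_end (grid x y) s = grid (x + step_width s) (y + step_height s)"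
  by (simp add: arc_end_eq complex_eq_iff algebra_simps)

lemma arc_end_in_arc_points: "arc_end p s \<in> arc_points p s"
  by (auto simp: arc_end_def arc_points_def)

lemma grid_in_quarter_plane: "grid x y \<in> quarter_plane \<longleftrightarrow> x \<ge> 0 \<and> y \<ge> 0"
  by (simp add: quarter_plane_def zero_le_mult_iff)

lemma arc_points_subset:
  assumes "step_at x y s" "x \<ge> 0" "y \<ge> 0" "y + step_height s \<ge> 0"
  shows "arc_points (grid x y) s \<subseteq> quarter_plane"
proof
  fix z assume "z \<in> arc_points (grid x y) s"
  then obtain t where t: "t \<in> closed_segment (start_angle s) (end_angle s)"
    and z: "z = arc_center (grid x y) s + 2 * cis t"
    by (auto simp: arc_points_def)
  have x: "real_of_int x \<ge> 0" using assms by simp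
  have s3: "sqrt 3 \<ge> (1::real)" by simp
  have sc: "cos t \<ge> -1" "sin t \<ge> -1" by auto
  have hi: "of_int k * sqrt 3 + 2 * sin t \<ge> 0" if "k \<ge> 2" for k
  proof -
    have "2 * 1 \<le> of_int k * sqrt 3" using that s3 by (intro mult_mono) auto
    thus ?thesis using sc(2) by linarith
  qed
  have nn: "of_int k * sqrt 3 \<ge> (0::real)" if "k \<ge> 0" for k
    using that by simp
  have sc2: "real_of_int x + 2 + 2 * cos t \<ge> 0" using x sc(1) by linarith
  have c: "cos t \<ge> cos u" if "t \<in> {0..u}" "u \<le> pi" for u
    using that by (intro cos_monotone_0_pi_le) auto
  have c': "cos t \<ge> cos u" if "t \<in> {2*pi-u..2*pi}" "u \<le> pi" for u
  proof -
    have "cos u \<le> cos (2 * pi - t)" using that by (intro cos_monotone_0_pi_le) auto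
    thus ?thesis by simp
  qed
  have sn: "sin t \<ge> 0" if "t \<in> {0..pi}" using that by (intro sin_ge_zero) auto
  show "z \<in> quarter_plane"
  proof (cases s)
    case U
    thus ?thesis using t assms x sc2 sn nn[of y]
      by (auto simp: z arc_center_grid quarter_plane_def closed_segment_eq_real_ivl split: if_splits)
  next
    case F
    have y: "y - 1 \<ge> 0" using assms(1,3) F by simp presburger
    show ?thesis using t x c[of "2 * pi / 3"] sn nn[OF y] F
      by (auto simp: z arc_center_grid quarter_plane_def closed_segment_eq_real_ivl cos_sin_angles(1)
               split: if_splits)
  next
    case D
    have y: "y - 1 \<ge> 0" using assms(1,3) D by simp presburger
    show ?thesis using t x c[of "pi / 3"] sn nn[OF y] D
      by (auto simp: z arc_center_grid quarter_plane_def closed_segment_eq_real_ivl cos_60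
               split: if_splits)
  next
    case Ub
    have y: "y + 1 \<ge> 2" using assms(1,3) Ub by simp presburger
    show ?thesis using t x c'[of "pi / 3"] sc hi[OF y] Ub
      by (auto simp: z arc_center_grid quarter_plane_def closed_segment_eq_real_ivl cos_60
               split: if_splits)
  next
    case Fb
    have y: "y + 1 \<ge> 2" using assms(1,3) Fb by simp presburger
    show ?thesis using t x c'[of "2 * pi / 3"] sc hi[OF y] Fb
      by (auto simp: z arc_center_grid quarter_plane_def closed_segment_eq_real_ivl cos_sin_angles(1)
               split: if_splits)
  next
    case Db
    have y: "y \<ge> 2" using assms(1,4) Db by simp presburger
    show ?thesis using t x sc sc2 hi[OF y] Db
      by (auto simp: z arc_center_grid quarter_plane_def)
  qed
qed

fun word_from :: "int \<Rightarrow> step list \<Rightarrow> bool" where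
  "word_from y [] \<longleftrightarrow> y \<ge> 0"
| "word_from y (s # w) \<longleftrightarrow> y \<ge> 0 \<and> word_from (y + step_height s) w"

lemma packing_from_iff:
  assumes "x \<ge> 0" "y \<ge> 0"
  shows "packing_from (grid x y) w \<longleftrightarrow>
           (w = [] \<or> step_at x y (hd w)) \<and> successively follows w \<and> word_from y w"
  using assms
proof (induction w arbitrary: x y)
  case Nil
  thus ?case by (simp add: grid_in_quarter_plane)
next
  case (Cons s w)
  let ?x = "x + int (step_width s)" and ?y = "y + step_height s"
  show ?case
  proof (cases "step_at x y s \<and> ?y \<ge> 0")
    case True
    have "packing_from (grid x y) (s # w) \<longleftrightarrow> packing_from (grid ?x ?y) w"
      using arc_points_subset[of x y s] True Cons.prems
      by (simp only: packing_from.simps arc_center_in_centers arc_end_grid) simp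
    also have "\<dots> \<longleftrightarrow> (w = [] \<or> step_at ?x ?y (hd w)) \<and> successively follows w \<and> word_from ?y w"
      using True Cons.prems by (intro Cons.IH) auto
    also have "\<dots> \<longleftrightarrow> successively follows (s # w) \<and> word_from y (s # w)"
      using step_at_next[of x y s "hd w"] True Cons.prems
      by (cases w) (auto simp del: step_at.simps)
    finally show ?thesis using True by (simp del: step_at.simps)
  next
    case False
    have "grid ?x ?y \<notin> quarter_plane" if "step_at x y s"
      using False that by (simp only: grid_in_quarter_plane) simp
    hence "\<not> packing_from (grid x y) (s # w)"
      using arc_end_in_arc_points[of "grid x y" s]
      by (auto simp: arc_center_in_centers arc_end_grid simp del: step_at.simps)
    moreover have "word_from z w \<Longrightarrow> z \<ge> 0" for z by (cases w) auto
    ultimately show ?thesis using False by (auto simp del: step_at.simps)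
  qed
qed

lemma word_from_iff:
  "word_from y w \<longleftrightarrow> (\<forall>k. y + sum_list (map step_height (take k w)) \<ge> 0)"
proof (induction w arbitrary: y)
  case (Cons s w)
  have "(\<forall>k. y + sum_list (map step_height (take k (s # w))) \<ge> 0) \<longleftrightarrow>
        y \<ge> 0 \<and> (\<forall>k. y + step_height s + sum_list (map step_height (take k w)) \<ge> 0)"
    (is "(\<forall>k. ?P k) \<longleftrightarrow> _ \<and> (\<forall>k. ?Q k)")
  proof -
    have "?P 0 \<longleftrightarrow> y \<ge> 0" "?P (Suc k) \<longleftrightarrow> ?Q k" for k by (simp_all add: add.assoc)
    thus ?thesis by (metis not0_implies_Suc)
  qed
  thus ?case using Cons.IH by simp
qed auto

theorem path_in_packing_iff_word:
  "path_in_packing w \<longleftrightarrow>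
     (w = [] \<or> hd w = U) \<and> successively follows w \<and> (\<forall>k. path_height (take k w) \<ge> 0)"
proof -
  have "path_in_packing w \<longleftrightarrow>
          (w = [] \<or> step_at 0 0 (hd w)) \<and> successively follows w \<and> (\<forall>k. path_height (take k w) \<ge> 0)"
    using packing_from_iff[of 0 0 w]
    by (simp add: path_in_packing_def path_height_eq word_from_iff zero_complex.code
             del: step_at.simps)
  moreover have "path_height (take 1 w) = -1" if "w \<noteq> []" "hd w = Db"
    using that by (cases w) (auto simp: path_height_eq)
  moreover have "step_at 0 0 s \<longleftrightarrow> s = U \<or> s = Db" for s by auto
  ultimately show ?thesis by (metis neg_0_le_iff_le not_one_le_zero)
qed

lemma length_le_path_width: "real (length w) \<le> path_width w"
proof -
  have "length w \<le> sum_list (map step_width w)"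
  proof (induction w)
    case (Cons s w) thus ?case by (cases s) auto
  qed simp
  thus ?thesis by (simp add: path_width_eq)
qed

lemma finite_partial_packing_paths: "finite (partial_packing_paths n)"
proof (rule finite_subset)
  have "s \<in> {U, F, D, Ub, Fb, Db}" for s by (cases s) auto
  thus "partial_packing_paths n \<subseteq> {w. set w \<subseteq> {U, F, D, Ub, Fb, Db} \<and> length w \<le> n}"
    using length_le_path_width by (metis (mono_tags, lifting) mem_Collect_eq of_nat_le_iff
      partial_packing_paths_def subsetI)
  show "finite {w. set w \<subseteq> {U, F, D, Ub, Fb, Db} \<and> length w \<le> n}"
    by (rule finite_lists_length_le) simp
qed

lemma partial_packing_paths_nonempty: "partial_packing_paths n \<noteq> {}"
proof -
  define us where "us m = concat (replicate m [U, Ub])" for m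
  define ds where "ds m = concat (replicate m [Db, D])" for m
  have us_simps: "us 0 = []" "us (Suc m) = U # Ub # us m"
    and ds_simps: "ds 0 = []" "ds (Suc m) = Db # D # ds m" for m
    by (simp_all add: us_def ds_def)
  have hd_ds: "ds m = [] \<or> hd (ds m) = Db" for m
    by (cases m) (auto simp: ds_simps)
  have hd_us: "us m @ ds k = [] \<or> hd (us m @ ds k) \<in> {U, Db}" for m k
    using hd_ds[of k] by (cases m) (auto simp: us_simps)
  have succ_ds: "successively follows (ds m)" for m
    by (induction m) (use hd_ds in \<open>auto simp: ds_simps successively_Cons\<close>)
  have succ: "successively follows (us m @ ds k)" for m k
    by (induction m) (use hd_us succ_ds in \<open>auto simp: us_simps successively_Cons\<close>)
  have word_ds: "word_from (2 * int m) (ds m)" for m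
    by (induction m) (auto simp: ds_simps algebra_simps)
  have word: "y \<ge> 0 \<Longrightarrow> y + 2 * int m = 2 * int k \<Longrightarrow> word_from y (us m @ ds k)" for y m k
    by (induction m arbitrary: y) (use word_ds in \<open>auto simp: us_simps algebra_simps\<close>)
  have sum_us: "sum_list (map step_height (us m)) = 2 * int m"
       "map step_width (us m) = replicate (2 * m) 1" for m
    by (induction m) (auto simp: us_simps)
  have sum_ds: "sum_list (map step_height (ds m)) = - 2 * int m" for m
    by (induction m) (auto simp: ds_simps)
  have "path_in_packing (us n @ ds n)"
    using succ[of n n] word[of 0 n n] hd_us[of n n]
    unfolding path_in_packing_iff_word path_height_eq word_from_iff
    by (cases n) (auto simp: us_simps ds_simps)
  moreover have "path_height (us n @ ds n) = 0"
    by (simp add: path_height_eq sum_us sum_ds)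
  ultimately have "packing_path (take n (us n) @ (drop n (us n) @ ds n))"
    by (simp add: packing_path_def Im_endpoint flip: append_assoc)
  hence "partial_packing_path (take n (us n))"
    unfolding partial_packing_path_def by blast
  moreover have "path_width (take n (us n)) = real n"
    by (simp add: path_width_eq take_map [symmetric] sum_us sum_list_replicate)
  ultimately show ?thesis by (auto simp: partial_packing_paths_def)
qed

end

theory Submission
  imports Defs "HOL-Real_Asymp.Real_Asymp"
begin

text \<open>
  Every path in the packing can be completed to a packing path, so the partial packing paths are
  just the words that respect the adjacency rules and stay above the axis. Observed at odd
  abscissae, such a path is a persistent random walk: with weight 2 it reverses its direction, with
  weight 1 it keeps its direction and its height changes by \<open>2\<close>. The height plus 1 or 2, according
  to the direction, is harmonic for the walk killed below the axis. Hence the expected height differs by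
  at most 2 from \<open>3 / p m\<close>, where \<open>m = (n - 1) div 2\<close> and \<open>p m\<close> is the probability that the walk survives
  \<open>m\<close> moves. The exponential eigenfunctions of the walk yield
  \<open>(\<Sum>m. p m * s^m) = 9 * (1 + s) / (4 * s^2) * (sqrt ((1 - s^2/9) / (1 - s^2)) - 1)\<close>.
  The coefficients of \<open>sqrt (1 - y/9)\<close> decay geometrically and those of \<open>1 / sqrt (1 - y)\<close> are
  asymptotic to \<open>1 / sqrt (pi * n)\<close>, so Tannery's theorem gives \<open>p m \<sim> 3 / sqrt (pi * m)\<close>.
\<close>

section \<open>Uniqueness of power series coefficients\<close>

text \<open>The constant coefficient is the limit of the sum as \<open>s\<close> tends to 0 from the
  right; dividing by \<open>s\<close> then shifts the coefficients down by one. Only positive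
  \<open>s\<close> are assumed because the generating function is computed only for
  \<open>0 < s < 1\<close>.\<close>

lemma powser_zero_coeffs:
  fixes a :: "nat \<Rightarrow> real"
  assumes "\<And>s. 0 < s \<Longrightarrow> s < 1 \<Longrightarrow> (\<lambda>n. a n * s ^ n) sums 0"
  shows "a n = 0"
  using assms
proof (induction n arbitrary: a)
  have a0: "a 0 = 0" if a: "\<And>s. 0 < s \<Longrightarrow> s < 1 \<Longrightarrow> (\<lambda>n. a n * s ^ n) sums 0" for a :: "nat \<Rightarrow> real"
  proof -
    define f where "f x = (\<Sum>n. a n * x ^ n)" for x
    have "(\<lambda>n. a n * x ^ n) sums f x" if "norm x < 1/2" for x
      using powser_inside[of a "1/2" x] a[of "1/2"] that
      by (auto simp: f_def sums_iff)
    hence "(f \<longlongrightarrow> a 0) (at 0)" by (intro powser_limit_0[of "1/2"]) auto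
    hence "(f \<longlongrightarrow> a 0) (at_right 0)" by (rule filterlim_mono) (auto simp: at_le)
    moreover have "eventually (\<lambda>x. f x = 0) (at_right (0::real))"
      using eventually_at_right_less[of 0] eventually_at_right_real[OF zero_less_one]
      by eventually_elim (use a in \<open>auto simp: f_def sums_iff\<close>)
    hence "(f \<longlongrightarrow> 0) (at_right 0)" by (rule tendsto_eventually)
    ultimately show ?thesis by (intro tendsto_unique[of "at_right (0::real)"]) auto
  qed
  {
    case 0 thus ?case by (rule a0)
  next
    case (Suc n)
    have "(\<lambda>n. a (Suc n) * s ^ n) sums 0" if s: "0 < s" "s < 1" for s
    proof -
      have "(\<lambda>n. a (Suc n) * s ^ Suc n) sums 0"
        using Suc.prems[OF s] a0[OF Suc.prems] by (subst sums_Suc_iff) auto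
      hence "(\<lambda>n. a (Suc n) * s ^ Suc n * inverse s) sums (0 * inverse s)"
        by (rule sums_mult2)
      thus ?thesis using s by (simp add: field_simps)
    qed
    thus ?case by (rule Suc.IH)
  }
qed

subsection \<open>The power series of a quotient of square roots\<close>

text \<open>The Taylor coefficients of \<open>1 / sqrt (1 - y)\<close>; those of
  \<open>sqrt (1 - y / 9)\<close> follow, and then their Cauchy product.\<close>

definition invsqrt_coeff :: "nat \<Rightarrow> real" where
  "invsqrt_coeff n = (-1) ^ n * (-1/2 gchoose n)"

definition sqrt_coeff :: "nat \<Rightarrow> real" where
  "sqrt_coeff n = (-1/9) ^ n * (1/2 gchoose n)"

definition quot_coeff :: "nat \<Rightarrow> real" where
  "quot_coeff n = (\<Sum>k\<le>n. sqrt_coeff k * invsqrt_coeff (n - k))"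

text \<open>Consecutive binomials have ratio \<open>(a - n) / (n + 1)\<close>, of absolute value at
  most 1 for such \<open>a\<close>.\<close>

lemma abs_gchoose_le_1:
  assumes "-1 \<le> a" "a \<le> (1::real)"
  shows "\<bar>a gchoose n\<bar> \<le> 1"
proof (induction n)
  case (Suc n)
  have "\<bar>a gchoose Suc n\<bar> = \<bar>a gchoose n\<bar> * (\<bar>a - n\<bar> / Suc n)"
  proof -
    have "real (Suc n) * (a gchoose Suc n) = (a - n) * (a gchoose n)"
      using gbinomial_absorb_comp[of a n] gbinomial_absorption[of n a] by simp
    hence "a gchoose Suc n = (a gchoose n) * ((a - n) / Suc n)"
      by (simp add: field_simps)
    thus ?thesis by (simp add: abs_mult)
  qed
  also have "\<dots> \<le> 1 * 1"
    using Suc assms by (intro mult_mono) auto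
  finally show ?case by simp
qed auto

lemma invsqrt_coeff_bound: "\<bar>invsqrt_coeff n\<bar> \<le> 1"
  using abs_gchoose_le_1[of "-1/2" n] by (simp add: invsqrt_coeff_def abs_mult)

lemma sqrt_coeff_bound: "\<bar>sqrt_coeff n\<bar> \<le> (1/9) ^ n"
proof -
  have "\<bar>sqrt_coeff n\<bar> = (1/9)^n * \<bar>1/2 gchoose n :: real\<bar>"
    by (simp add: sqrt_coeff_def abs_mult power_abs)
  also have "\<dots> \<le> (1/9)^n * 1"
    by (intro mult_left_mono abs_gchoose_le_1) auto
  finally show ?thesis by simp
qed

lemma invsqrt_sums:
  assumes "\<bar>y\<bar> < (1::real)"
  shows "(\<lambda>n. invsqrt_coeff n * y ^ n) sums (1 / sqrt (1 - y))"
proof -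
  have "(\<lambda>n. (-1/2 gchoose n) * (- y) ^ n) sums (1 + (- y)) powr (-1/2)"
    using assms by (intro gen_binomial_real) auto
  also have "(1 + (- y)) powr (-1/2) = 1 / sqrt (1 - y)"
    using assms by (simp add: powr_minus_divide powr_half_sqrt)
  also have "(\<lambda>n. (-1/2 gchoose n) * (- y) ^ n) = (\<lambda>n. invsqrt_coeff n * y ^ n)"
    by (simp add: invsqrt_coeff_def fun_eq_iff power_minus' mult_ac power_minus[of y])
  finally show ?thesis .
qed

lemma sqrt_sums:
  assumes "\<bar>y\<bar> < (9::real)"
  shows "(\<lambda>n. sqrt_coeff n * y ^ n) sums sqrt (1 - y / 9)"
proof -
  have "(\<lambda>n. (1/2 gchoose n) * (- y / 9) ^ n) sums (1 + (- y / 9)) powr (1/2)"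
    using assms by (intro gen_binomial_real) auto
  also have "(1 + (- y / 9)) powr (1/2) = sqrt (1 - y / 9)"
    using assms by (simp add: powr_half_sqrt)
  also have "(\<lambda>n. (1/2 gchoose n) * (- y / 9) ^ n) = (\<lambda>n. sqrt_coeff n * y ^ n)"
    by (simp add: sqrt_coeff_def fun_eq_iff mult_ac power_minus[of "y/9"] power_divide power_minus[of "1/9"])
  finally show ?thesis .
qed

lemma quot_sums:
  assumes "0 \<le> y" "y < (1::real)"
  shows "(\<lambda>n. quot_coeff n * y ^ n) sums sqrt ((1 - y / 9) / (1 - y))"
proof -
  have geo: "summable (\<lambda>n. y ^ n)" using assms by (intro summable_geometric) auto
  have "(\<lambda>n. \<Sum>i\<le>n. (sqrt_coeff i * y ^ i) * (invsqrt_coeff (n - i) * y ^ (n - i)))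
          sums ((\<Sum>n. sqrt_coeff n * y ^ n) * (\<Sum>n. invsqrt_coeff n * y ^ n))"
  proof (rule Cauchy_product_sums)
    show "summable (\<lambda>n. norm (invsqrt_coeff n * y ^ n))"
    proof (rule summable_comparison_test'[OF geo])
      show "norm (norm (invsqrt_coeff n * y ^ n)) \<le> y ^ n" for n
        using mult_right_mono[OF invsqrt_coeff_bound, of "y ^ n" n] assms by (simp add: abs_mult)
    qed
    have "\<bar>sqrt_coeff n\<bar> \<le> 1" for n
      using sqrt_coeff_bound[of n] power_le_one[of "1/9::real" n] by simp
    thus "summable (\<lambda>n. norm (sqrt_coeff n * y ^ n))"
      using assms
      by (intro summable_comparison_test'[OF geo]) (simp add: abs_mult mult_left_le_one_le)
  qed
  also have "(\<lambda>n. \<Sum>i\<le>n. (sqrt_coeff i * y ^ i) * (invsqrt_coeff (n - i) * y ^ (n - i)))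
      = (\<lambda>n. quot_coeff n * y ^ n)"
    unfolding quot_coeff_def sum_distrib_right
    by (intro ext sum.cong) (auto simp: mult_ac simp flip: power_add)
  also have "(\<Sum>n. sqrt_coeff n * y ^ n) * (\<Sum>n. invsqrt_coeff n * y ^ n)
      = sqrt (1 - y / 9) * (1 / sqrt (1 - y))"
    using sqrt_sums[of y] invsqrt_sums[of y] assms by (simp add: sums_iff)
  finally show ?thesis by (simp add: real_sqrt_divide)
qed

lemma invsqrt_coeff_asymp: "(\<lambda>n. sqrt n * invsqrt_coeff n) \<longlonglongrightarrow> 1 / sqrt pi"
proof -
  have "(\<lambda>n. (- 1 / 2 gchoose n) / ((- 1) ^ n / exp ((- 1 / 2 + 1) * ln (real n)))) \<longlonglongrightarrow> 1 / sqrt pi"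
    using gbinomial_asymptotic[of "-1/2::real"] by (simp add: Gamma_one_half_real field_simps)
  moreover have "\<forall>\<^sub>F n in sequentially.
      (- 1 / 2 gchoose n) / ((- 1) ^ n / exp ((- 1 / 2 + 1) * ln (real n))) = sqrt n * invsqrt_coeff n"
    using eventually_gt_at_top[of 0]
  proof eventually_elim
    case (elim n)
    have "exp (ln (real n) / 2) = sqrt n"
      using elim by (simp flip: powr_half_sqrt add: powr_def)
    thus ?case by (simp add: invsqrt_coeff_def field_simps)
  qed
  ultimately show ?thesis by (rule Lim_transform_eventually)
qed

lemma quot_coeff_asymp: "(\<lambda>n. sqrt n * quot_coeff n) \<longlonglongrightarrow> sqrt (8/9) / sqrt pi"
proof -
  obtain K where K: "\<And>n. \<bar>sqrt (real n) * invsqrt_coeff n\<bar> \<le> K"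
    using convergent_imp_Bseq[OF convergentI[OF invsqrt_coeff_asymp]] by (auto simp: Bseq_def)
  have K0: "K \<ge> 0" using K[of 0] by simp
  \<comment> \<open>\<open>sqrt n\<close> times the \<open>k\<close>-th term of the convolution,
    extended by 0 beyond \<open>n\<close> so that the sum becomes a series to which Tannery's
    theorem applies.\<close>
  define a where "a k n = (if k \<le> n then sqrt (real n) * invsqrt_coeff (n - k) * sqrt_coeff k else 0)"
    for k n :: nat
  have bound: "norm (a k n) \<le> (K + real k) * (1/9) ^ k" for k n
  proof (cases "k \<le> n")
    case True
    \<comment> \<open>Subadditivity replaces \<open>sqrt n\<close> by \<open>sqrt (n - k)\<close>,
      which matches the argument of \<open>invsqrt_coeff\<close>. The cost is a factor linear in
      \<open>k\<close>, harmless against the geometric decay of \<open>sqrt_coeff\<close>.\<close>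
    have "sqrt (real n) \<le> sqrt (real (n - k)) + sqrt k"
      using True sqrt_add_le_add_sqrt[of "real (n - k)" "real k"] by (simp add: of_nat_diff)
    also have "sqrt k \<le> k"
      by (cases "k = 0") (auto intro!: real_le_lsqrt simp: power2_eq_square)
    finally have "sqrt (real n) * \<bar>invsqrt_coeff (n - k)\<bar>
        \<le> (sqrt (real (n - k)) + k) * \<bar>invsqrt_coeff (n - k)\<bar>"
      by (intro mult_right_mono) auto
    also have "\<dots> \<le> K + k * 1"
      unfolding distrib_right
      using K[of "n - k"] invsqrt_coeff_bound[of "n - k"] mult_left_mono
      by (intro add_mono) (auto simp: abs_mult mult_left_le)
    finally show ?thesis
      using True sqrt_coeff_bound[of k] K0 unfolding a_def
      by (auto simp: abs_mult intro!: mult_mono)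
  qed (use K0 in \<open>auto simp: a_def\<close>)
  have lim: "(\<lambda>n. a k n) \<longlonglongrightarrow> 1 / sqrt pi * sqrt_coeff k" for k
  proof -
    have "(\<lambda>n. (sqrt n * invsqrt_coeff n) * sqrt ((real n + k) / n) * sqrt_coeff k)
            \<longlonglongrightarrow> (1 / sqrt pi) * sqrt 1 * sqrt_coeff k"
    proof (intro tendsto_mult tendsto_real_sqrt invsqrt_coeff_asymp tendsto_const)
      have "(\<lambda>n. 1 + real k / real n) \<longlonglongrightarrow> 1 + 0"
        by (intro tendsto_add tendsto_const lim_const_over_n)
      moreover have "\<forall>\<^sub>F n in sequentially. 1 + real k / real n = (real n + k) / n"
        using eventually_gt_at_top[of 0] by eventually_elim (simp add: field_simps)
      ultimately show "(\<lambda>n. (real n + k) / n) \<longlonglongrightarrow> 1"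
        by (simp add: filterlim_cong)
    qed
    moreover have "\<forall>\<^sub>F n in sequentially.
        (sqrt n * invsqrt_coeff n) * sqrt ((real n + k) / n) * sqrt_coeff k = a k (n + k)"
      using eventually_gt_at_top[of 0]
      by eventually_elim (simp add: a_def real_sqrt_divide)
    ultimately have "(\<lambda>n. a k (n + k)) \<longlonglongrightarrow> (1 / sqrt pi) * sqrt 1 * sqrt_coeff k"
      by (rule Lim_transform_eventually)
    thus ?thesis by (simp add: LIMSEQ_offset)
  qed
  have "summable (\<lambda>k. real k * (1/9::real) ^ k)"
  proof (rule summable_comparison_test')
    show "summable (\<lambda>k. (1/3::real) ^ k)" by (intro summable_geometric) auto
    have "real k \<le> 3 ^ k" for k
      using of_nat_less_two_power[of k, where ?'a = real] power_mono[of 2 "3::real" k] by linarith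
    hence "real k * (1/9) ^ k \<le> 3 ^ k * (1/9) ^ k" for k by (intro mult_right_mono) auto
    thus "norm (real k * (1/9) ^ k) \<le> (1/3::real) ^ k" for k
      by (simp flip: power_mult_distrib)
  qed
  hence "summable (\<lambda>k. K * (1/9) ^ k + real k * (1/9::real) ^ k)"
    by (intro summable_add summable_mult summable_geometric) auto
  hence M: "summable (\<lambda>k. (K + real k) * (1/9::real) ^ k)"
    by (simp add: distrib_right)
  have "(\<lambda>n. \<Sum>k. a k n) \<longlonglongrightarrow> (\<Sum>k. 1 / sqrt pi * sqrt_coeff k)"
    using tannerys_theorem[of a _ sequentially, OF lim _ M] bound by (simp add: always_eventually)
  moreover have "(\<Sum>k. a k n) = sqrt n * quot_coeff n" for n
  proof -
    have "(\<Sum>k. a k n) = (\<Sum>k\<le>n. a k n)"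
      by (rule suminf_finite) (auto simp: a_def)
    thus ?thesis by (simp add: a_def quot_coeff_def sum_distrib_left mult_ac)
  qed
  \<comment> \<open>The coefficients of \<open>sqrt (1 - y / 9)\<close> are summed at the
    singularity \<open>y = 1\<close> of the other factor.\<close>
  moreover have "(\<Sum>k. 1 / sqrt pi * sqrt_coeff k) = 1 / sqrt pi * sqrt (8/9)"
    using sqrt_sums[of 1] by (subst suminf_mult) (auto simp: sums_iff)
  ultimately show ?thesis by simp
qed

subsection \<open>Survival probabilities\<close>

text \<open>
  At odd height \<open>2 * j + 1\<close> a path is going up (it just made a step \<open>U\<close> or \<open>Fb\<close>) or down
  (it just made \<open>F\<close> or \<open>Db\<close>). Over the next two units of width it has three continuations,
  two of which reverse the direction at the same height while the third keeps the direction and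
  moves by two. The functions below are the probabilities that \<open>m\<close> such moves, each chosen
  uniformly, never lead below the axis.
\<close>

fun up_alive down_alive :: "nat \<Rightarrow> nat \<Rightarrow> real" where
  "up_alive 0 j = 1"
| "down_alive 0 j = 1"
| "up_alive (Suc m) j = (2 * down_alive m j + up_alive m (Suc j)) / 3"
| "down_alive (Suc m) j = (2 * up_alive m j + (case j of 0 \<Rightarrow> 0 | Suc i \<Rightarrow> down_alive m i)) / 3"

text \<open>If \<tau> is the first time below the axis, the sum of P(\<tau> > m) s^m is (1 -
  E(s^\<tau>)) / (1 - s). An explicit candidate for E(s^\<tau>) satisfies the first-step equations,
  and the partial sums converge to the resulting value because each move contracts the error by
  \<open>s\<close>.\<close>

lemma up_alive_sums:
  assumes s: "0 < s" "s < (1::real)"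
  defines "y \<equiv> ((3 - s\<^sup>2) - sqrt ((9 - s\<^sup>2) * (1 - s\<^sup>2))) / 2"
  shows "(\<lambda>m. up_alive m 0 * s ^ m) sums (3 * (1 - y) / ((3 - y) * (1 - s)))"
proof -
  define R where "R = sqrt ((9 - s\<^sup>2) * (1 - s\<^sup>2))"
  have s2: "s\<^sup>2 < 1" "s\<^sup>2 > 0" using s by (auto simp: power_less_one_iff)
  have R2: "R\<^sup>2 = (9 - s\<^sup>2) * (1 - s\<^sup>2)" using s2 by (simp add: R_def)
  have R0: "R \<ge> 0" using s2 by (simp add: R_def)
  have y_eq: "y = ((3 - s\<^sup>2) - R) / 2" by (simp add: y_def R_def)
  \<comment> \<open>The characteristic equation of the first-step recursion, in terms of
    \<open>y = s * x\<close>. Its roots have product \<open>s\<^sup>2\<close>, so the two candidates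
    for \<open>x\<close> are reciprocal; the smaller root gives the one with bounded powers.\<close>
  have quad: "y\<^sup>2 - (3 - s\<^sup>2) * y + s\<^sup>2 = 0"
    using R2 unfolding y_eq by (simp add: field_simps power2_eq_square)
  have "(1 - s\<^sup>2)\<^sup>2 \<le> R\<^sup>2" unfolding R2 power2_eq_square[of "1 - s\<^sup>2"] using s2
    by (intro mult_right_mono) auto
  hence R1: "1 - s\<^sup>2 \<le> R" using R0 by (rule power2_le_imp_le)
  define x where "x = y / s"
  have "R\<^sup>2 < (3 - s\<^sup>2)\<^sup>2" using s2 unfolding R2 by (simp add: power2_eq_square algebra_simps)
  hence "R < 3 - s\<^sup>2" using s2 by (intro power2_less_imp_less[of R]) auto
  hence y0: "y > 0" by (simp add: y_eq)
  have y1: "y \<le> 1" using R1 by (simp add: y_eq)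
  have x0: "x > 0" using y0 s by (simp add: x_def)
  have ys: "y \<le> s"
  proof -
    have "(3 - s\<^sup>2 - 2 * s)\<^sup>2 \<le> R\<^sup>2"
    proof -
      have "3 - s\<^sup>2 - 2 * s = (3 + s) * (1 - s)" by (simp add: power2_eq_square algebra_simps)
      moreover have "R\<^sup>2 = ((3 + s) * (1 - s)) * ((3 - s) * (1 + s))"
        unfolding R2 by (simp add: power2_eq_square algebra_simps)
      moreover have "(3 + s) * (1 - s) \<le> (3 - s) * (1 + s)" using s by (simp add: algebra_simps)
      ultimately show ?thesis
        unfolding power2_eq_square[of "3 - s\<^sup>2 - 2 * s"] using s by (auto intro!: mult_left_mono)
    qed
    hence "3 - s\<^sup>2 - 2 * s \<le> R" using R0 by (rule power2_le_imp_le)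
    thus ?thesis by (simp add: y_eq)
  qed
  have x1: "x \<le> 1" using ys s by (simp add: x_def)
  \<comment> \<open>The generating functions \<open>E(s^\<tau>)\<close> of the first time \<open>\<tau>\<close> below the axis, when
    starting downwards and upwards: the solution of the first-step equations decaying in \<open>j\<close>.\<close>
  define gd where "gd j = x ^ Suc j" for j :: nat
  define gu where "gu j = 2 * s / (3 - y) * x ^ Suc j" for j :: nat
  have sx: "s * x = y" using s by (simp add: x_def)
  have gu_rec: "s * ((2 * gd j + gu (Suc j)) / 3) = gu j" for j
  proof -
    have "s * ((2 * gd j + gu (Suc j)) / 3) = x ^ Suc j * (2 * s + (s * x) * (2 * s / (3 - y))) / 3"
      by (simp add: gd_def gu_def algebra_simps)
    also have "\<dots> = gu j" using y1 unfolding sx gu_def by (simp add: field_simps)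
    finally show ?thesis .
  qed
  have gd_rec: "s * ((2 * gu j + (case j of 0 \<Rightarrow> 1 | Suc i \<Rightarrow> gd i)) / 3) = gd j" for j
  proof -
    have "(case j of 0 \<Rightarrow> 1 | Suc i \<Rightarrow> gd i) = x ^ j"
      by (simp add: gd_def split: nat.splits)
    hence "s * ((2 * gu j + (case j of 0 \<Rightarrow> 1 | Suc i \<Rightarrow> gd i)) / 3)
            = x ^ j * ((4 * s * (s * x) / (3 - y) + s) / 3)"
      by (simp add: gu_def algebra_simps)
    also have "(4 * s * (s * x) / (3 - y) + s) / 3 = x"
    proof -
      have "4 * s\<^sup>2 * y + s\<^sup>2 * (3 - y) = 3 * y * (3 - y)"
        using quad by (simp add: algebra_simps power2_eq_square)
      hence "4 * s * y + s * (3 - y) = 3 * x * (3 - y)"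
        using s by (simp add: x_def field_simps power2_eq_square)
      thus ?thesis using y1 unfolding sx by (simp add: field_simps)
    qed
    finally show ?thesis by (simp add: gd_def)
  qed
  have gd01: "0 \<le> gd j" "gd j \<le> 1" for j
    using x0 x1 power_le_one[of x "Suc j"] by (auto simp: gd_def simp del: power_Suc)
  have gu01: "0 \<le> gu j" "gu j \<le> 1" for j
  proof -
    have "2 * s / (3 - y) \<le> 1" "2 * s / (3 - y) \<ge> 0" using s y1 by (auto simp: field_simps)
    thus "0 \<le> gu j" "gu j \<le> 1" 
      using gd01[of j] mult_le_one[of "2 * s / (3 - y)" "gd j"]
        mult_nonneg_nonneg[of "2 * s / (3 - y)" "gd j"]
      unfolding gu_def gd_def by auto
  qed
  define Pu where "Pu n j = (\<Sum>m<n. up_alive m j * s ^ m)" for n j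
  define Pd where "Pd n j = (\<Sum>m<n. down_alive m j * s ^ m)" for n j
  have Pu_Suc: "Pu (Suc n) j = 1 + s * ((2 * Pd n j + Pu n (Suc j)) / 3)" for n j
    unfolding Pu_def Pd_def sum.lessThan_Suc_shift
    by (simp add: sum_distrib_left sum.distrib add_divide_distrib sum_divide_distrib algebra_simps)
  have Pd_Suc: "Pd (Suc n) j = 1 + s * ((2 * Pu n j + (case j of 0 \<Rightarrow> 0 | Suc i \<Rightarrow> Pd n i)) / 3)" for n j
    unfolding Pu_def Pd_def sum.lessThan_Suc_shift
    by (cases j)
      (simp_all add: sum_distrib_left sum.distrib add_divide_distrib sum_divide_distrib algebra_simps)
  \<comment> \<open>The limit is an exact fixed point of the recursion, so the error after a move is
    \<open>s\<close> times the weighted average of the previous errors.\<close>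
  have step_error: "1 + s * ((2 * p + q) / 3) - (1 - s * ((2 * a + b) / 3)) / (1 - s) =
      s * ((2 * (p - (1 - a) / (1 - s)) + (q - (1 - b) / (1 - s))) / 3)" for p q a b
  proof -
    define r where "r = 1 / (1 - s)"
    have r: "z / (1 - s) = z * r" for z by (simp add: r_def)
    have "1 - r + s * r = 0" using s by (simp add: r_def field_simps)
    moreover have "1 + s * ((2 * p + q) / 3) - (1 - s * ((2 * a + b) / 3)) * r =
        s * ((2 * (p - (1 - a) * r) + (q - (1 - b) * r)) / 3) + (1 - r + s * r)"
      by (simp add: field_simps)
    ultimately show ?thesis unfolding r by simp
  qed
  \<comment> \<open>The empty sums are off by at most \<open>1 / (1 - s)\<close>, since
    \<open>gu\<close> and \<open>gd\<close> lie in [0, 1]; every move gains a factor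
    \<open>s\<close>.\<close>
  have main: "\<bar>Pu n j - (1 - gu j) / (1 - s)\<bar> \<le> s ^ n / (1 - s) \<and>
              \<bar>Pd n j - (1 - gd j) / (1 - s)\<bar> \<le> s ^ n / (1 - s)" for n j
  proof (induction n arbitrary: j)
    case 0
    show ?case using s gd01[of j] gu01[of j]
      by (auto simp: Pu_def Pd_def abs_divide intro!: divide_right_mono)
  next
    case (Suc n)
    define e where "e = s ^ n / (1 - s)"
    have e0: "e \<ge> 0" using s by (simp add: e_def)
    have eS: "s ^ Suc n / (1 - s) = s * e" by (simp add: e_def)
    define du where "du j = Pu n j - (1 - gu j) / (1 - s)" for j
    define dd where "dd j = Pd n j - (1 - gd j) / (1 - s)" for j
    have IH: "\<bar>du j\<bar> \<le> e" "\<bar>dd j\<bar> \<le> e" for j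
      using Suc.IH[of j] by (auto simp: du_def dd_def e_def)
    have "Pu (Suc n) j - (1 - gu j) / (1 - s) = s * ((2 * dd j + du (Suc j)) / 3)"
      unfolding Pu_Suc du_def dd_def by (subst gu_rec[symmetric]) (rule step_error)
    also have "\<bar>\<dots>\<bar> \<le> s * e"
      unfolding abs_mult using IH[of j] IH[of "Suc j"] s by (intro mult_mono) auto
    finally have 1: "\<bar>Pu (Suc n) j - (1 - gu j) / (1 - s)\<bar> \<le> s * e" .
    \<comment> \<open>The error just below the axis is 0: the survival sum there is 0, and the
      boundary value 1 of \<open>gd\<close> gives \<open>(1 - 1) / (1 - s) = 0\<close>.\<close>
    define d where "d = (case j of 0 \<Rightarrow> 0 | Suc i \<Rightarrow> dd i)"
    have "\<bar>d\<bar> \<le> e" using IH e0 by (auto simp: d_def split: nat.splits)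
    have "Pd (Suc n) j - (1 - gd j) / (1 - s) = s * ((2 * du j + d) / 3)"
    proof -
      have "d = (case j of 0 \<Rightarrow> 0 | Suc i \<Rightarrow> Pd n i) - (1 - (case j of 0 \<Rightarrow> 1 | Suc i \<Rightarrow> gd i)) / (1 - s)"
        by (simp add: d_def dd_def split: nat.splits)
      thus ?thesis
        unfolding Pd_Suc du_def by (subst gd_rec[symmetric]) (simp only: step_error)
    qed
    also have "\<bar>\<dots>\<bar> \<le> s * e"
      unfolding abs_mult using IH[of j] \<open>\<bar>d\<bar> \<le> e\<close> s by (intro mult_mono) auto
    finally show ?case using 1 unfolding eS by simp
  qed
  have "(\<lambda>n. s ^ n / (1 - s)) \<longlonglongrightarrow> 0 / (1 - s)"
    using s by (intro tendsto_divide LIMSEQ_power_zero tendsto_const) auto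
  hence "(\<lambda>n. s ^ n / (1 - s)) \<longlonglongrightarrow> 0" by simp
  hence "(\<lambda>n. Pu n 0 - (1 - gu 0) / (1 - s)) \<longlonglongrightarrow> 0"
    by (rule Lim_null_comparison[rotated]) (use main[of _ 0] in auto)
  hence "(\<lambda>n. Pu n 0) \<longlonglongrightarrow> (1 - gu 0) / (1 - s)" by (simp add: LIM_zero_iff)
  moreover have "(1 - gu 0) / (1 - s) = 3 * (1 - y) / ((3 - y) * (1 - s))"
  proof -
    have "gu 0 = 2 * y / (3 - y)" using s by (simp add: gu_def x_def)
    hence "1 - gu 0 = 3 * (1 - y) / (3 - y)" using y1 by (simp add: field_simps)
    thus ?thesis by simp
  qed
  ultimately show ?thesis by (simp add: sums_def Pu_def)
qed

text \<open>A series in \<open>s\<^sup>2\<close> multiplied by \<open>1 + s\<close> has equal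
  coefficients at \<open>2 * l\<close> and \<open>2 * l + 1\<close>, hence the \<open>div 2\<close>.
  The factor \<open>s\<^sup>2\<close> shifts the index by two, hence the \<open>Suc\<close>.\<close>

lemma up_alive_eq: "up_alive m 0 = 9 / 4 * quot_coeff (Suc (m div 2))"
proof -
  \<comment> \<open>Solving for \<open>y\<close> in \<open>up_alive_sums\<close>, \<open>4/9 * s^2\<close> times the generating function
    is \<open>(1 + s) * (sqrt ((1 - s^2/9) / (1 - s^2)) - 1)\<close>.\<close>
  define a where "a k = (case k of 0 \<Rightarrow> 0 | Suc 0 \<Rightarrow> 0 | Suc (Suc m) \<Rightarrow> 4 / 9 * up_alive m 0) 
       + (if k < 2 then 1 else 0) - quot_coeff (k div 2)" for k
  have "(\<lambda>k. a k * s ^ k) sums 0" if s: "0 < s" "s < 1" for s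
  proof -
    have s2: "s\<^sup>2 < 1" "s\<^sup>2 > 0" using s by (auto simp: power_less_one_iff)
    define R where "R = sqrt ((9 - s\<^sup>2) * (1 - s\<^sup>2))"
    define Q where "Q = sqrt ((1 - s\<^sup>2 / 9) / (1 - s\<^sup>2))"
    define y where "y = ((3 - s\<^sup>2) - R) / 2"
    define b where "b k = (case k of 0 \<Rightarrow> 0 | Suc 0 \<Rightarrow> 0 | Suc (Suc m) \<Rightarrow> 4 / 9 * up_alive m 0)" for k
    have R2: "R\<^sup>2 = (9 - s\<^sup>2) * (1 - s\<^sup>2)" using s2 by (simp add: R_def)
    have "R \<ge> 0" using s2 by (simp add: R_def)
    have RQ: "R = 3 * Q * (1 - s\<^sup>2)"
    proof (rule power2_eq_imp_eq)
      show "R\<^sup>2 = (3 * Q * (1 - s\<^sup>2))\<^sup>2"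
        using s2 unfolding R2 power_mult_distrib Q_def by (simp add: field_simps power2_eq_square)
    qed (use s2 \<open>R \<ge> 0\<close> in \<open>auto simp: Q_def\<close>)
    have val: "4 / 9 * s\<^sup>2 * (3 * (1 - y) / ((3 - y) * (1 - s))) = (1 + s) * (Q - 1)"
    proof -
      \<comment> \<open>This consequence of \<open>R2\<close> lets the factor \<open>3 - y\<close>
        cancel, leaving an expression linear in \<open>R\<close>.\<close>
      have *: "(1 - y) * (4 * s\<^sup>2) = (3 - y) * (R - 3 * (1 - s\<^sup>2))"
        using R2 by (simp add: y_def field_simps power2_eq_square)
      have "3 - y = (3 + s\<^sup>2 + R) / 2" by (simp add: y_def field_simps)
      also have "\<dots> > 0"
        using \<open>R \<ge> 0\<close> by (intro divide_pos_pos add_pos_nonneg) auto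
      finally have "3 - y > 0" .
      have "4 / 9 * u * (3 * v / (c * d)) = v * (4 * u) / (c * (3 * d))" for u v c d :: real
        by (simp add: mult_ac)
      hence "4 / 9 * s\<^sup>2 * (3 * (1 - y) / ((3 - y) * (1 - s))) =
              ((1 - y) * (4 * s\<^sup>2)) / ((3 - y) * (3 * (1 - s)))" .
      also have "\<dots> = (R - 3 * (1 - s\<^sup>2)) / (3 * (1 - s))"
        unfolding * using \<open>3 - y > 0\<close> by simp
      also have "R - 3 * (1 - s\<^sup>2) = (3 * (1 - s)) * ((1 + s) * (Q - 1))"
        unfolding RQ by (simp add: algebra_simps power2_eq_square)
      finally show ?thesis using s by simp
    qed
    have "(\<lambda>m. up_alive m 0 * s ^ m) sums (3 * (1 - y) / ((3 - y) * (1 - s)))"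
      using up_alive_sums[OF s] by (simp add: y_def R_def)
    hence "(\<lambda>m. 4 / 9 * s\<^sup>2 * (up_alive m 0 * s ^ m)) sums ((1 + s) * (Q - 1))"
      unfolding val[symmetric] by (rule sums_mult)
    hence "(\<lambda>m. b (Suc (Suc m)) * s ^ Suc (Suc m)) sums ((1 + s) * (Q - 1))"
      by (simp add: b_def power2_eq_square mult_ac)
    hence "(\<lambda>m. b (Suc m) * s ^ Suc m) sums ((1 + s) * (Q - 1))"
      by (subst (asm) sums_Suc_iff) (simp add: b_def)
    hence b: "(\<lambda>m. b m * s ^ m) sums ((1 + s) * (Q - 1))"
      by (subst (asm) sums_Suc_iff) (simp add: b_def)
    have "(\<lambda>l. quot_coeff l * (s\<^sup>2) ^ l) sums Q"
      unfolding Q_def using s2 by (intro quot_sums) auto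
    \<comment> \<open>The series of \<open>Q\<close> fills the even powers of \<open>s\<close> and
      \<open>s\<close> times that series the odd ones; together they give
      \<open>(1 + s) * Q\<close>.\<close>
    from sums_if[OF sums_mult[OF this, of s] this]
    have "(\<lambda>k. if even k then quot_coeff (k div 2) * (s\<^sup>2) ^ (k div 2)
            else s * (quot_coeff ((k - 1) div 2) * (s\<^sup>2) ^ ((k - 1) div 2))) sums (s * Q + Q)"
      by simp
    also have "(\<lambda>k. if even k then quot_coeff (k div 2) * (s\<^sup>2) ^ (k div 2)
            else s * (quot_coeff ((k - 1) div 2) * (s\<^sup>2) ^ ((k - 1) div 2)))
          = (\<lambda>k. quot_coeff (k div 2) * s ^ k)"
    proof
      fix k show "(if even k then quot_coeff (k div 2) * (s\<^sup>2) ^ (k div 2)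
            else s * (quot_coeff ((k - 1) div 2) * (s\<^sup>2) ^ ((k - 1) div 2)))
          = quot_coeff (k div 2) * s ^ k"
        by (cases "even k") (auto elim!: evenE oddE simp: power_mult)
    qed
    finally have q: "(\<lambda>k. quot_coeff (k div 2) * s ^ k) sums (s * Q + Q)" .
    have "(\<lambda>k. if k \<in> {..<2} then s ^ k else 0) sums (\<Sum>k<2. s ^ k)"
      by (rule sums_If_finite_set) auto
    hence o: "(\<lambda>k. (if k < 2 then 1 else 0) * s ^ k) sums (1 + s)"
      by (simp add: if_distrib[of "\<lambda>z. z * _"] numeral_2_eq_2 cong: if_cong)
    have "(\<lambda>k. (b k * s ^ k + (if k < 2 then 1 else 0) * s ^ k) - quot_coeff (k div 2) * s ^ k)
       sums ((1 + s) * (Q - 1) + (1 + s) - (s * Q + Q))"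
      by (intro sums_diff sums_add b o q)
    also have "(1 + s) * (Q - 1) + (1 + s) - (s * Q + Q) = 0" by (simp add: algebra_simps)
    also have "(\<lambda>k. (b k * s ^ k + (if k < 2 then 1 else 0) * s ^ k) - quot_coeff (k div 2) * s ^ k)
        = (\<lambda>k. a k * s ^ k)"
      by (simp add: a_def b_def algebra_simps fun_eq_iff)
    finally show ?thesis .
  qed
  hence "a (Suc (Suc m)) = 0" by (rule powser_zero_coeffs)
  thus ?thesis by (simp add: a_def)
qed

text \<open>The index \<open>Suc (m div 2)\<close> grows like \<open>m / 2\<close>, which
  contributes the factor \<open>sqrt 2\<close> to the limit of
  \<open>quot_coeff_asymp\<close>.\<close>

lemma up_alive_asymp: "(\<lambda>m. sqrt m * up_alive m 0) \<longlonglongrightarrow> 3 / sqrt pi"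
proof -
  define k where "k m = Suc (m div 2)" for m :: nat
  have k: "filterlim k at_top sequentially"
    unfolding k_def by real_asymp
  have "(\<lambda>m. sqrt (real m / k m) * (9 / 4 * (sqrt (k m) * quot_coeff (k m))))
          \<longlonglongrightarrow> sqrt 2 * (9 / 4 * (sqrt (8/9) / sqrt pi))"
  proof (intro tendsto_mult tendsto_const tendsto_real_sqrt filterlim_compose[OF quot_coeff_asymp k])
    show "(\<lambda>m. real m / k m) \<longlonglongrightarrow> 2"
      unfolding k_def by real_asymp
  qed
  also have "(\<lambda>m. sqrt (real m / k m) * (9 / 4 * (sqrt (k m) * quot_coeff (k m))))
      = (\<lambda>m. sqrt m * up_alive m 0)"
    by (simp add: up_alive_eq k_def real_sqrt_divide fun_eq_iff)
  also have "sqrt 2 * (9 / 4 * (sqrt (8/9) / sqrt pi)) = 3 / sqrt pi"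
  proof -
    have "sqrt 2 * sqrt (8 / 9) = sqrt ((4/3)\<^sup>2)"
      unfolding real_sqrt_mult[symmetric] by (simp add: power2_eq_square)
    hence *: "sqrt 2 * sqrt (8 / 9) = 4 / 3" unfolding real_sqrt_abs by simp
    have "sqrt 2 * (9 / 4 * (sqrt (8/9) / sqrt pi)) = 9 / 4 * (sqrt 2 * sqrt (8/9)) / sqrt pi"
      by (simp only: ac_simps times_divide_eq_right)
    also have "\<dots> = 3 / sqrt pi" unfolding * by simp
    finally show ?thesis .
  qed
  finally show ?thesis .
qed

subsection \<open>Counting continuations of a path\<close>

text \<open>\<open>t\<close> is the last step already made, \<open>y\<close> the height reached, and
  \<open>n\<close> the width still to be filled.\<close>

definition continuations :: "step \<Rightarrow> int \<Rightarrow> nat \<Rightarrow> step list set" where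
  "continuations t y n =
     {w. successively follows (t # w) \<and> word_from y w \<and> sum_list (map step_width w) = n}"

text \<open>With a general weight \<open>\<phi>\<close> the same recursions serve for counting
  (\<open>\<phi>\<close> constantly 1) and for adding up final heights
  (\<open>\<phi> = of_int\<close>).\<close>

definition height_sum :: "(int \<Rightarrow> real) \<Rightarrow> step \<Rightarrow> int \<Rightarrow> nat \<Rightarrow> real" where
  "height_sum \<phi> t y n = (\<Sum>w\<in>continuations t y n. \<phi> (y + sum_list (map step_height w)))"

lemma step_width_pos: "step_width s > 0"
  by (cases s) auto

lemma length_le_sum_width: "length w \<le> sum_list (map step_width w)"
  using length_le_path_width[of w] by (simp add: path_width_eq)

lemma UNIV_step: "UNIV = {U, F, D, Ub, Fb, Db}"
  using step.exhaust by auto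

lemma finite_continuations: "finite (continuations t y n)"
proof (rule finite_subset)
  show "continuations t y n \<subseteq> {w. set w \<subseteq> UNIV \<and> length w \<le> n}"
    using length_le_sum_width by (auto simp: continuations_def)
  show "finite {w. set w \<subseteq> (UNIV :: step set) \<and> length w \<le> n}"
    by (rule finite_lists_length_le) (simp add: UNIV_step)
qed

lemma continuations_0: "y \<ge> 0 \<Longrightarrow> continuations t y 0 = {[]}"
proof -
  have "w = []" if "sum_list (map step_width w) = 0" for w
    using length_le_sum_width[of w] that by simp
  thus "y \<ge> 0 \<Longrightarrow> continuations t y 0 = {[]}" by (auto simp: continuations_def)
qed

lemma word_from_imp_nonneg: "word_from y w \<Longrightarrow> y \<ge> 0"
  by (cases w) auto

lemma continuations_neg: "y < 0 \<Longrightarrow> continuations t y n = {}"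
  using word_from_imp_nonneg by (force simp: continuations_def)

lemma continuations_rec:
  assumes "y \<ge> 0" "n > 0"
  shows "continuations t y n =
    (\<Union>s\<in>{s. follows t s \<and> step_width s \<le> n}.
       (#) s ` continuations s (y + step_height s) (n - step_width s))"
    (is "_ = ?R")
proof (intro equalityI subsetI)
  fix w assume w: "w \<in> continuations t y n"
  with assms obtain s v where "w = s # v" by (cases w) (auto simp: continuations_def)
  with w show "w \<in> ?R" by (auto simp: continuations_def)
next
  fix w assume "w \<in> ?R"
  thus "w \<in> continuations t y n" using assms by (auto simp: continuations_def)
qed

lemma height_sum_rec:
  assumes "n > 0" "y \<ge> 0"
  shows "height_sum \<phi> t y n =
    (\<Sum>s | follows t s \<and> step_width s \<le> n.
       height_sum \<phi> s (y + step_height s) (n - step_width s))"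
proof -
  have "finite {s. follows t s \<and> step_width s \<le> n}"
    by (rule finite_subset[OF subset_UNIV]) (simp add: UNIV_step)
  hence "height_sum \<phi> t y n = (\<Sum>s | follows t s \<and> step_width s \<le> n.
     \<Sum>w\<in>(#) s ` continuations s (y + step_height s) (n - step_width s).
       \<phi> (y + sum_list (map step_height w)))"
    unfolding height_sum_def continuations_rec[OF assms(2,1)]
    by (intro sum.UNION_disjoint) (auto simp: finite_continuations)
  thus ?thesis
    by (simp add: height_sum_def sum.reindex add.assoc)
qed

lemma height_sum_0: "height_sum \<phi> t y 0 = (if y \<ge> 0 then \<phi> y else 0)"
  by (auto simp: height_sum_def continuations_0 continuations_neg)

lemma height_sum_neg: "y < 0 \<Longrightarrow> height_sum \<phi> t y n = 0"
  by (simp add: height_sum_def continuations_neg)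

text \<open>The previous step matters only through its admissible successors, so the six steps fall
  into three classes, represented by \<open>U\<close>, \<open>F\<close> and
  \<open>D\<close>.\<close>

lemma height_sum_cong:
  assumes "follows t = follows t'"
  shows "height_sum \<phi> t y n = height_sum \<phi> t' y n"
proof -
  have "continuations t y n = continuations t' y n"
    using assms by (auto simp: continuations_def successively_Cons)
  thus ?thesis by (simp add: height_sum_def)
qed

lemma height_sum_Fb: "height_sum \<phi> Fb y n = height_sum \<phi> U y n"
  and height_sum_Db: "height_sum \<phi> Db y n = height_sum \<phi> F y n"
  and height_sum_Ub: "height_sum \<phi> Ub y n = height_sum \<phi> D y n"
  by (rule height_sum_cong; simp add: fun_eq_iff)+

lemma follows_width:
  "{s. follows U s \<and> step_width s \<le> Suc (Suc n)} = {F, Ub}"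
  "{s. follows F s \<and> step_width s \<le> Suc (Suc n)} = {Fb, D}"
  "{s. follows D s \<and> step_width s \<le> Suc n} = {U, Db}"
  "{s. follows U s \<and> step_width s \<le> Suc 0} = {Ub}"
  "{s. follows F s \<and> step_width s \<le> Suc 0} = {D}"
  by auto

lemmas height_sum_Suc = height_sum_rec[OF zero_less_Suc]

lemma height_sum_D:
  assumes "y \<ge> 0"
  shows "height_sum \<phi> D y (Suc n) = height_sum \<phi> U (y + 1) n + height_sum \<phi> F (y - 1) n"
  unfolding height_sum_Suc[OF assms] follows_width by (simp add: height_sum_Db)

text \<open>After \<open>U\<close> or \<open>Fb\<close>, two units of width are filled by
  \<open>F\<close> or by \<open>Ub Db\<close>, both turning downwards at the same height, or by
  \<open>Ub U\<close>, which rises by 2.\<close>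

lemma height_sum_U:
  assumes "y \<ge> 0"
  shows "height_sum \<phi> U y (Suc (Suc n)) = 2 * height_sum \<phi> F y n + height_sum \<phi> U (y + 2) n"
  using assms unfolding height_sum_Suc[OF assms] follows_width
  by (simp add: height_sum_Ub height_sum_D add.commute[of 2 y])

text \<open>The mirror image of \<open>height_sum_U\<close>, with \<open>Fb\<close>,
  \<open>D U\<close> and \<open>D Db\<close>. The bound on \<open>y\<close> keeps the height after
  \<open>D\<close> nonnegative; if \<open>y - 2\<close> is negative, its term is 0.\<close>

lemma height_sum_F:
  assumes "y \<ge> 1"
  shows "height_sum \<phi> F y (Suc (Suc n)) = 2 * height_sum \<phi> U y n + height_sum \<phi> F (y - 2) n"
proof -
  have "y \<ge> 0" using assms by simp
  with assms show ?thesis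
    unfolding height_sum_Suc[OF \<open>y \<ge> 0\<close>] follows_width by (simp add: height_sum_Fb height_sum_D)
qed

lemma height_sum_1:
  assumes "y \<ge> 1"
  shows "height_sum \<phi> U y (Suc 0) = \<phi> (y + 1)" "height_sum \<phi> F y (Suc 0) = \<phi> (y - 1)"
proof -
  have "y \<ge> 0" using assms by simp
  with assms show "height_sum \<phi> U y (Suc 0) = \<phi> (y + 1)" "height_sum \<phi> F y (Suc 0) = \<phi> (y - 1)"
    unfolding height_sum_Suc[OF \<open>y \<ge> 0\<close>] follows_width by (simp_all add: height_sum_0)
qed

text \<open>Each of the \<open>m\<close> moves has three continuations, hence the factor
  \<open>3 ^ m\<close>. A leftover unit of width admits a single step, \<open>Ub\<close> or
  \<open>D\<close>, which from an odd height stays above or on the axis and so leaves the count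
  unchanged.\<close>

lemma height_sum_const_1:
  assumes "r \<le> 1"
  shows "height_sum (\<lambda>_. 1) U (2 * int j + 1) (2 * m + r) = 3 ^ m * up_alive m j \<and>
         height_sum (\<lambda>_. 1) F (2 * int j + 1) (2 * m + r) = 3 ^ m * down_alive m j"
proof (induction m arbitrary: j)
  case 0
  show ?case using assms by (cases r) (auto simp: height_sum_0 height_sum_1)
next
  case (Suc m)
  show ?case
    using Suc.IH[of j] Suc.IH[of "Suc j"] Suc.IH[of "j - 1"]
    by (cases j) (simp_all add: height_sum_U height_sum_F height_sum_neg algebra_simps)
qed

text \<open>
  The function equal to \<open>h + 2\<close> at height \<open>h\<close> going up, and \<open>h + 1\<close> going down, is harmonic and
  vanishes where a path first goes below the axis (height \<open>-1\<close>, going down).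
\<close>

lemma height_sum_bounds:
  assumes "r \<le> 1"
  defines "H \<equiv> height_sum of_int" and "N \<equiv> height_sum (\<lambda>_. 1)"
  shows "H U (2 * int j + 1) (2 * m + r) + N U (2 * int j + 1) (2 * m + r) \<le> 3 ^ m * (2 * j + 3) \<and>
         3 ^ m * (2 * j + 3) \<le> H U (2 * int j + 1) (2 * m + r) + 2 * N U (2 * int j + 1) (2 * m + r) \<and>
         H F (2 * int j + 1) (2 * m + r) + N F (2 * int j + 1) (2 * m + r) \<le> 3 ^ m * (2 * j + 2) \<and>
         3 ^ m * (2 * j + 2) \<le> H F (2 * int j + 1) (2 * m + r) + 2 * N F (2 * int j + 1) (2 * m + r)"
  unfolding H_def N_def
proof (induction m arbitrary: j)
  case 0
  \<comment> \<open>For \<open>r = 0\<close> the harmonic function is the height plus 2 going up and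
    plus 1 going down. The extra step for \<open>r = 1\<close> swaps these two offsets, so the
    bounds must allow both.\<close>
  show ?case using assms by (cases r) (auto simp: height_sum_0 height_sum_1)
next
  case (Suc m)
  show ?case
    using Suc.IH[of j] Suc.IH[of "Suc j"] Suc.IH[of "j - 1"]
    by (cases j) (simp_all add: height_sum_U height_sum_F height_sum_neg algebra_simps)
qed

subsection \<open>Partial packing paths are the paths in the packing\<close>

text \<open>A parity invariant of paths starting with \<open>U\<close>: \<open>Ub\<close> and
  \<open>D\<close> end at even heights, the other four steps at odd heights.\<close>

definition parity_ok :: "step \<Rightarrow> int \<Rightarrow> bool" where
  "parity_ok t y \<longleftrightarrow> (t \<in> {Ub, D} \<longleftrightarrow> even y)"

lemma parity_ok_append:
  assumes "successively follows (t # w)" "parity_ok t y"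
  shows "parity_ok (last (t # w)) (y + sum_list (map step_height w))"
  using assms
proof (induction w arbitrary: t y)
  case (Cons s w)
  have "parity_ok s (y + step_height s)"
    using Cons.prems by (cases t; cases s) (auto simp: parity_ok_def)
  with Cons.IH[of s "y + step_height s"] Cons.prems show ?case by (simp add: add.assoc)
qed auto

text \<open>From each step a word of at most two steps leads strictly down and ends with
  \<open>D\<close>, so the descent can be iterated. Parity provides the room: after
  \<open>Ub\<close> or \<open>D\<close> a positive height is at least 2, as \<open>Db D\<close>
  requires.\<close>

lemma descent_exists:
  assumes "parity_ok t (int k)"
  shows "\<exists>v. successively follows (t # v) \<and> word_from (int k) v \<and>
             int k + sum_list (map step_height v) = 0"
  using assms
proof (induction k arbitrary: t rule: less_induct)
  case (less k)
  show ?case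
  proof (cases "k = 0")
    case True
    thus ?thesis by (intro exI[of _ "[]"]) auto
  next
    case False
    define u where "u = (if t \<in> {Ub, D} then [Db, D] else if t \<in> {U, Fb} then [F, D] else [D])"
    define l where "l = (if t \<in> {Ub, D} then k - 2 else k - 1)"
    have l: "l < k" "int l = int k + sum_list (map step_height u)"
         "parity_ok D (int l)"
      using False less.prems by (auto simp: l_def u_def parity_ok_def)
    from less.IH[OF l(1,3)] obtain v where v: "successively follows (D # v)"
      "word_from (int l) v" "int l + sum_list (map step_height v) = 0" by blast
    show ?thesis
      using v l(1,2) by (intro exI[of _ "u @ v"]) (cases t; force simp: u_def split: if_splits)
  qed
qed

lemma word_from_append:
  "word_from y (v @ w) \<longleftrightarrow> word_from y v \<and> word_from (y + sum_list (map step_height v)) w"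
  by (induction v arbitrary: y) (auto simp: add.assoc dest: word_from_imp_nonneg)

lemma path_in_packing_Cons:
  "path_in_packing (s # w) \<longleftrightarrow> s = U \<and> successively follows (U # w) \<and> word_from 1 w"
  using word_from_iff[of 0 "s # w"] by (auto simp: path_in_packing_iff_word path_height_eq)

text \<open>Prefixes inherit adjacency and nonnegativity; conversely, \<open>descent_exists\<close>
  brings any path back to the axis.\<close>

lemma partial_packing_path_iff: "partial_packing_path w \<longleftrightarrow> path_in_packing w"
proof
  assume "partial_packing_path w"
  then obtain v where v: "path_in_packing (w @ v)"
    by (auto simp: partial_packing_path_def packing_path_def)
  show "path_in_packing w"
  proof (cases w)
    case (Cons s w')
    have "successively follows ((U # w') @ v)" "word_from 1 (w' @ v)" "s = U"
      using v by (simp_all add: Cons path_in_packing_Cons)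
    thus ?thesis
      unfolding Cons path_in_packing_Cons successively_append_iff word_from_append by auto
  qed (auto simp: path_in_packing_iff_word path_height_eq)
next
  assume w: "path_in_packing w"
  show "partial_packing_path w"
  proof (cases w)
    case Nil
    thus ?thesis using w by (auto simp: partial_packing_path_def packing_path_def endpoint_def intro!: exI[of _ "[]"])
  next
    case (Cons s u)
    with w have u: "s = U" "successively follows (U # u)" "word_from 1 u"
      by (auto simp: path_in_packing_Cons)
    define h where "h = 1 + sum_list (map step_height u)"
    have "h \<ge> 0" using u(3) word_from_append[of 1 u "[]"] by (simp add: h_def)
    moreover have "parity_ok (last w) h"
      using parity_ok_append[OF u(2), of 1] Cons u(1) by (simp add: h_def parity_ok_def)
    ultimately obtain v where v: "successively follows (last w # v)" "word_from h v"
        "h + sum_list (map step_height v) = 0"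
      using descent_exists[of "last w" "nat h"] by auto
    have "successively follows (U # u @ v)"
      using u(2) v(1) Cons u(1)
      by (cases v) (auto simp: successively_append_iff simp flip: append_Cons)
    hence "path_in_packing (w @ v)"
      using u v Cons by (simp add: path_in_packing_Cons word_from_append h_def)
    moreover have "path_height (w @ v) = 0"
      using v(3) Cons u(1) by (simp add: path_height_eq h_def add.assoc)
    ultimately show ?thesis
      unfolding partial_packing_path_def packing_path_def Im_endpoint by auto
  qed
qed

subsection \<open>The expected height\<close>

lemma partial_packing_paths_Suc:
  "partial_packing_paths (Suc n) = (#) U ` continuations U 1 n"
proof (intro equalityI subsetI)
  fix w assume "w \<in> partial_packing_paths (Suc n)"
  hence w: "path_in_packing w" "sum_list (map step_width w) = Suc n"
    by (auto simp: partial_packing_paths_def partial_packing_path_iff path_width_eq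
        simp del: of_nat_Suc)
  then obtain s v where sv: "w = s # v" by (cases w) auto
  with w have "s = U" "v \<in> continuations U 1 n"
    by (auto simp: path_in_packing_Cons continuations_def)
  with sv show "w \<in> (#) U ` continuations U 1 n" by auto
qed (auto simp: partial_packing_paths_def partial_packing_path_iff path_width_eq
      path_in_packing_Cons continuations_def)

definition mean_height :: "nat \<Rightarrow> real" where
  "mean_height n = measure_pmf.expectation (pmf_of_set (partial_packing_paths n))
                     (\<lambda>w. real_of_int (path_height w))"

text \<open>The first step \<open>U\<close> leads to height 1 going up, where the harmonic function
  is 3. Dividing \<open>H + N \<le> 3 ^ m * 3 \<le> H + 2 * N\<close> by
  \<open>N = 3 ^ m * p\<close> gives both bounds.\<close>

lemma mean_height_bounds:
  fixes n :: nat
  defines "p \<equiv> up_alive (n div 2) 0"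
  shows "p > 0" "3 / p - 2 \<le> mean_height (Suc n)" "mean_height (Suc n) \<le> 3 / p - 1"
proof -
  define N where "N = height_sum (\<lambda>_. 1) U 1 n"
  define H where "H = height_sum of_int U 1 n"
  define m where "m = n div 2"
  have n: "2 * m + n mod 2 = n" and r: "n mod 2 \<le> 1" by (auto simp: m_def)
  have N: "N = 3 ^ m * p"
    using height_sum_const_1[OF r, of 0 m] unfolding n by (simp add: N_def p_def m_def)
  have bounds: "H + N \<le> 3 ^ m * 3" "3 ^ m * 3 \<le> H + 2 * N"
    using height_sum_bounds[OF r, of 0 m] unfolding n by (simp_all add: N_def H_def)
  have card: "real (card (partial_packing_paths (Suc n))) = N"
    by (simp add: partial_packing_paths_Suc card_image N_def height_sum_def)
  hence "N > 0"
    using partial_packing_paths_nonempty[of "Suc n"] finite_partial_packing_paths[of "Suc n"]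
    by (metis card_gt_0_iff of_nat_0_less_iff)
  thus p: "p > 0" by (simp add: N zero_less_mult_iff)
  have "mean_height (Suc n) = (\<Sum>w\<in>partial_packing_paths (Suc n). real_of_int (path_height w)) / N"
    unfolding mean_height_def card[symmetric]
    by (rule integral_pmf_of_set[OF partial_packing_paths_nonempty finite_partial_packing_paths])
  also have "(\<Sum>w\<in>partial_packing_paths (Suc n). real_of_int (path_height w)) = H"
    by (simp add: partial_packing_paths_Suc sum.reindex path_height_eq H_def height_sum_def)
  finally have E: "mean_height (Suc n) = H / N" .
  have "3 / p = 3 ^ m * 3 / N" using p by (simp add: N)
  thus "3 / p - 2 \<le> mean_height (Suc n)" "mean_height (Suc n) \<le> 3 / p - 1"
    using bounds \<open>N > 0\<close> by (simp_all add: E field_simps)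
qed

theorem corollary4:
  shows "(\<lambda>n. measure_pmf.expectation (pmf_of_set (partial_packing_paths n))
                (\<lambda>w. real_of_int (path_height w)))
         \<sim>[at_top] (\<lambda>n. sqrt (pi * real n / 2))"
proof -
  define p where "p n = up_alive (n div 2) 0" for n :: nat
  \<comment> \<open>The target is taken at \<open>Suc n\<close>, because the bounds concern width
    \<open>Suc n\<close>; the shift is undone at the end.\<close>
  define g where "g n = sqrt (pi * real (Suc n) / 2)" for n :: nat
  have g: "g n > 0" for n by (simp add: g_def)
  have half: "filterlim (\<lambda>n::nat. n div 2) at_top sequentially"
    by real_asymp
  have inv_g: "(\<lambda>n. 1 / g n) \<longlonglongrightarrow> 0"
    unfolding g_def by real_asymp
  have "(\<lambda>n. 3 / (sqrt (n div 2) * p n) * (sqrt (n div 2) / g n))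
          \<longlonglongrightarrow> 3 / (3 / sqrt pi) * (1 / sqrt pi)"
  proof (rule tendsto_mult[OF tendsto_divide[OF tendsto_const]])
    show "(\<lambda>n. sqrt (n div 2) * p n) \<longlonglongrightarrow> 3 / sqrt pi"
      unfolding p_def by (rule filterlim_compose[OF up_alive_asymp half])
    have "(\<lambda>n. sqrt (real (n div 2) / (pi * real (Suc n) / 2))) \<longlonglongrightarrow> sqrt (1 / pi)"
    proof (rule tendsto_real_sqrt)
      have "(\<lambda>n. real (n div 2) / (real (Suc n) / 2)) \<longlonglongrightarrow> 1" by real_asymp
      hence "(\<lambda>n. real (n div 2) / (real (Suc n) / 2) / pi) \<longlonglongrightarrow> 1 / pi"
        by (intro tendsto_divide tendsto_const) auto
      thus "(\<lambda>n. real (n div 2) / (pi * real (Suc n) / 2)) \<longlonglongrightarrow> 1 / pi"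
        by (simp add: mult_ac)
    qed
    thus "(\<lambda>n. sqrt (n div 2) / g n) \<longlonglongrightarrow> 1 / sqrt pi"
      by (simp add: g_def real_sqrt_divide real_sqrt_mult)
  qed auto
  moreover have "3 / (3 / sqrt pi) * (1 / sqrt pi) = 1" by simp
  moreover have "\<forall>\<^sub>F n in sequentially.
      3 / (sqrt (n div 2) * p n) * (sqrt (n div 2) / g n) = 3 / p n / g n"
    \<comment> \<open>\<open>n > 1\<close> makes \<open>n div 2\<close> nonzero, so that its square
      root cancels.\<close>
    using eventually_gt_at_top[of 1] by eventually_elim (auto simp: field_simps)
  ultimately have main: "(\<lambda>n. 3 / p n / g n) \<longlonglongrightarrow> 1"
    using Lim_transform_eventually by fastforce
  \<comment> \<open>The bounded error in \<open>mean_height_bounds\<close> vanishes after division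
    by \<open>g n\<close>, which tends to infinity.\<close>
  have "(\<lambda>n. mean_height (Suc n) / g n) \<longlonglongrightarrow> 1"
  proof (rule tendsto_sandwich)
    show "(\<lambda>n. 3 / p n / g n - 2 * (1 / g n)) \<longlonglongrightarrow> 1"
      using tendsto_diff[OF main tendsto_mult[OF tendsto_const inv_g]] by simp
    show "(\<lambda>n. 3 / p n / g n - 1 / g n) \<longlonglongrightarrow> 1"
      using tendsto_diff[OF main inv_g] by simp
    have "3 / p n / g n - 2 * (1 / g n) \<le> mean_height (Suc n) / g n" for n
      using divide_right_mono[OF mean_height_bounds(2)[of n] less_imp_le[OF g]]
      by (simp add: p_def diff_divide_distrib)
    thus "\<forall>\<^sub>F n in sequentially. 3 / p n / g n - 2 * (1 / g n) \<le> mean_height (Suc n) / g n"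
      by simp
    have "mean_height (Suc n) / g n \<le> 3 / p n / g n - 1 / g n" for n
      using divide_right_mono[OF mean_height_bounds(3)[of n] less_imp_le[OF g]]
      by (simp add: p_def diff_divide_distrib)
    thus "\<forall>\<^sub>F n in sequentially. mean_height (Suc n) / g n \<le> 3 / p n / g n - 1 / g n"
      by simp
  qed
  hence "(\<lambda>n. mean_height n / sqrt (pi * real n / 2)) \<longlonglongrightarrow> 1"
    unfolding g_def by (rule LIMSEQ_imp_Suc)
  hence "mean_height \<sim>[at_top] (\<lambda>n. sqrt (pi * real n / 2))"
    by (rule asymp_equivI')
  thus ?thesis unfolding mean_height_def[abs_def] .
qed

end
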